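(* For any $f\in\mathcal{H}$ and $w\in\mathcal{A}$, one has \[ \tilde{f}(wx)=(F_f\diamond w)\,x . \]
   Context: $\mathcal{A}=\mathbb{Q}\langle x,y\rangle$ is the noncommutative polynomial algebra over $\mathbb{Q}$ in two indeterminates $x,y$. For $u\in\mathcal{A}$, $L_u,R_u:\mathcal{A}\to\mathcal{A}$ are the $\mathbb{Q}$-linear maps $L_u(w)=uw$, $R_u(w)=wu$; $L_y^{-1}:y\mathcal{A}\to\mathcal{A}$ is the inverse of $L_y:\mathcal{A}\to y\mathcal{A}$. Hopf algebra $\mathcal{H}$. A rooted tree is a finite (nonempty, non-planar) tree with a distinguished root; a forest is a finite commutative product $t_1\cdots t_n$ of rooted trees; $\mathbb{I}$ is the empty forest. $\mathcal{H}$ (Connes–Kreimer Hopf algebra) is the $\mathbb{Q}$-vector space with basis the forests, with commutative multiplication of forests and unit $\mathbb{I}$. The linear map $B_+:\mathcal{H}\to\mathcal{H}$ sends a forest to the rooted tree obtained by grafting all its roots onto a common new root; $B_+(\mathbb{I})=\bullet$ is the one-vertex tree. Every rooted tree is $B_+(f)$ for a unique forest $f$. The coproduct $\Delta$ is the algebra homomorphism ($\Delta(gh)=\Delta(g)\Delta(h)$, $\Delta(\mathbb{I})=\mathbb{I}\otimes\mathbb{I}$) with $\Delta(t)=\mathbb{I}\otimes t+(B_+\otimes\mathrm{id})(\Delta(f))$ for a tree $t=B_+(f)$. Sweedler notation: $\Delta(f)=\sum_{(f)}f'\otimes f''$. Rooted tree maps. For $f\in\mathcal{H}$ the $\mathbb{Q}$-linear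 map $\tilde f:\mathcal{A}\to\mathcal{A}$ (linear in $f$) is defined recursively by: (1) $\tilde{\mathbb{I}}=\mathrm{id}$; (2) $\tilde{\bullet}(x)=yx$, $\tilde{\bullet}(y)=-yx$; (3) $\tilde t(u)=L_yL_{x+2y}L_y^{-1}\tilde f(u)$ if $t=B_+(f)$ is a tree with $f\neq\mathbb{I}$; (4) $\tilde f(u)=\tilde g(\tilde h(u))$ if $f=gh$; (5) $\tilde f(uw)=\sum_{(f)}\tilde{f'}(u)\tilde{f''}(w)$; where $w\in\mathcal{A}$, $u\in\{x,y\}$. It is known that this is well defined and that $f\mapsto\tilde f$ is an algebra homomorphism $\mathcal{H}\to\mathrm{End}(\mathcal{A})$. Product $\diamond$. The $\mathbb{Q}$-bilinear, commutative, associative product $\diamond$ on $\mathcal{A}$ is defined by $w\diamond 1=1\diamond w=w$ and $xw_1\diamond xw_2=x(w_1\diamond xw_2)-x(yw_1\diamond w_2)$, $xw_1\diamond yw_2=x(w_1\diamond yw_2)+y(xw_1\diamond w_2)$, $yw_1\diamond xw_2=y(w_1\diamond xw_2)+x(yw_1\diamond w_2)$, $yw_1\diamond yw_2=y(w_1\diamond yw_2)-y(xw_1\diamond w_2)$ for $w,w_1,w_2\in\mathcal{A}$. Polynomials $F_f$. For a forest $f$, $F_f\in\mathbb{Q}+y\mathcal{A}$ is defined recursively by: $F_{\mathbb{I}}=1$; $F_{\bullet}=y$; $F_t=L_yL_{x+2y}L_y^{-1}(F_f)$ if $t=B_+(f)$ is a tree and $f\neq\mathbb{I}$; $F_f=F_g\diamond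 F_h$ if $f=gh$. It is extended linearly to $f\in\mathcal{H}$. *)

theory Defs
  imports Complex_Main "HOL-Library.Multiset" "HOL-Library.Poly_Mapping" "HOL-Library.Product_Plus"
begin

section \<open>Vector spaces over the rationals with a given basis\<close>

text \<open>The space with basis \<open>'k\<close> is \<open>'k \<Rightarrow>\<^sub>0 rat\<close>. If \<open>'k\<close> is an (additively written) monoid,
  the multiplication of \<open>'k \<Rightarrow>\<^sub>0 rat\<close> is that of the monoid algebra.\<close>

abbreviation basis_vec :: "'k \<Rightarrow> 'k \<Rightarrow>\<^sub>0 rat" where
  "basis_vec k \<equiv> Poly_Mapping.single k 1"

definition qscale :: "rat \<Rightarrow> ('k \<Rightarrow>\<^sub>0 rat) \<Rightarrow> 'k \<Rightarrow>\<^sub>0 rat" where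
  "qscale c = Poly_Mapping.map ((*) c)"

definition lin_ext :: "('k \<Rightarrow> 'l \<Rightarrow>\<^sub>0 rat) \<Rightarrow> ('k \<Rightarrow>\<^sub>0 rat) \<Rightarrow> 'l \<Rightarrow>\<^sub>0 rat" where
  "lin_ext g p = (\<Sum>k\<in>Poly_Mapping.keys p. qscale (Poly_Mapping.lookup p k) (g k))"

lemma lookup_qscale [simp]: "Poly_Mapping.lookup (qscale c p) k = c * Poly_Mapping.lookup p k"
  by (simp add: qscale_def Poly_Mapping.map.rep_eq when_def)

interpretation qscale: vector_space qscale
  by standard (auto intro!: poly_mapping_eqI simp: lookup_add algebra_simps)

lemma lin_ext_superset:
  assumes "finite S" "Poly_Mapping.keys p \<subseteq> S"
  shows "lin_ext g p = (\<Sum>k\<in>S. qscale (Poly_Mapping.lookup p k) (g k))"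
  unfolding lin_ext_def using assms
  by (intro sum.mono_neutral_left) (auto simp: in_keys_iff)

lemma lin_ext_add: "lin_ext g (p + q) = lin_ext g p + lin_ext g q"
proof -
  let ?S = "Poly_Mapping.keys p \<union> Poly_Mapping.keys q"
  have "Poly_Mapping.keys (p + q) \<subseteq> ?S" by (rule keys_add)
  then show ?thesis
    by (simp add: lin_ext_superset[of ?S] lookup_add qscale.scale_left_distrib sum.distrib)
qed

lemma lin_ext_qscale: "lin_ext g (qscale c p) = qscale c (lin_ext g p)"
proof -
  have "Poly_Mapping.keys (qscale c p) \<subseteq> Poly_Mapping.keys p"
    by (auto simp: in_keys_iff)
  then show ?thesis
    by (simp add: lin_ext_superset[of "Poly_Mapping.keys p"] qscale.scale_sum_right)
qed

lemma lin_ext_basis_vec [simp]: "lin_ext g (basis_vec k) = g k"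
  by (simp add: lin_ext_def)

lemma linear_lin_ext: "Vector_Spaces.linear qscale qscale (lin_ext g)"
  by standard (simp_all add: lin_ext_add lin_ext_qscale)

lemma qscale_mult_left: "qscale c p * q = qscale c (p * q)"
  for p q :: "'k::monoid_add \<Rightarrow>\<^sub>0 rat"
  by (simp add: qscale_def mult_map_scale_conv_mult mult.assoc)

lemma qscale_mult_right: "p * qscale c q = qscale c (p * q)"
  for p q :: "'k::monoid_add \<Rightarrow>\<^sub>0 rat"
proof -
  have *: "Poly_Mapping.single 0 c * q = q * Poly_Mapping.single 0 c" for q :: "'k \<Rightarrow>\<^sub>0 rat"
  proof (rule poly_mapping_eqI)
    fix k
    have "(\<Sum>m. Poly_Mapping.lookup (Poly_Mapping.single 0 c) l * Poly_Mapping.lookup q m when k = l + m)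
        = (c * Poly_Mapping.lookup q k when l = 0)" for l :: 'k
      by (cases "l = 0") (simp_all add: lookup_single)
    moreover have "(\<Sum>m. Poly_Mapping.lookup q l * Poly_Mapping.lookup (Poly_Mapping.single 0 c) m when k = l + m)
        = (Poly_Mapping.lookup q k * c when l = k)" for l :: 'k
    proof -
      have "(Poly_Mapping.lookup q l * Poly_Mapping.lookup (Poly_Mapping.single 0 c) m when k = l + m)
         = ((Poly_Mapping.lookup q l * c when k = l) when m = 0)" for m
        by (auto simp: lookup_single when_def)
      then show ?thesis by (auto simp: when_def)
    qed
    ultimately show "Poly_Mapping.lookup (Poly_Mapping.single 0 c * q) k
        = Poly_Mapping.lookup (q * Poly_Mapping.single 0 c) k"
      by (simp add: lookup_mult Sum_any_right_distrib mult_when mult.commute)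
  qed
  show ?thesis
    by (simp add: qscale_def mult_map_scale_conv_mult flip: mult.assoc) (simp add: *)
qed


lemma basis_induct [case_names basis add scale]:
  assumes "\<And>k. P (basis_vec k)" "\<And>p q. P p \<Longrightarrow> P q \<Longrightarrow> P (p + q)" "\<And>c p. P p \<Longrightarrow> P (qscale c p)"
  shows "P (p :: 'k \<Rightarrow>\<^sub>0 rat)"
proof (induction p rule: update_induct)
  case const
  have "P (qscale 0 (basis_vec undefined))" by (intro assms)
  then show ?case by simp
next
  case (update f a b)
  have "Poly_Mapping.update a b f = f + qscale b (basis_vec a)"
    using update(1) by (intro poly_mapping_eqI)
      (auto simp: lookup_add lookup_update lookup_single when_def in_keys_iff)
  then show ?case using update assms by simp
qed


section \<open>The noncommutative polynomial algebra\<close>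

datatype letter = Lx | Ly

datatype word = Word (letters: "letter list")

instantiation word :: monoid_add
begin

definition zero_word :: word where
  "zero_word = Word []"

definition plus_word :: "word \<Rightarrow> word \<Rightarrow> word" where
  "plus_word u v = Word (letters u @ letters v)"

instance
  by standard (simp_all add: zero_word_def plus_word_def)

end

type_synonym ncpoly = "word \<Rightarrow>\<^sub>0 rat"

definition X :: ncpoly where "X = basis_vec (Word [Lx])"
definition Y :: ncpoly where "Y = basis_vec (Word [Ly])"

text \<open>The inverse of left multiplication by \<open>y\<close>; only its values on \<open>y\<A>\<close> are meaningful.\<close>

definition Ly_inv :: "ncpoly \<Rightarrow> ncpoly" where
  "Ly_inv = inv ((*) Y)"

lemma X_basis_vec: "X * basis_vec (Word u) = basis_vec (Word (Lx # u))"
  and Y_basis_vec: "Y * basis_vec (Word u) = basis_vec (Word (Ly # u))"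
  by (simp_all add: X_def Y_def mult_single plus_word_def)

lemma ncpoly_induct [case_names one X Y add scale]:
  assumes "P 1" "\<And>p. P p \<Longrightarrow> P (X * p)" "\<And>p. P p \<Longrightarrow> P (Y * p)"
    "\<And>p q. P p \<Longrightarrow> P q \<Longrightarrow> P (p + q)" "\<And>c p. P p \<Longrightarrow> P (qscale c p)"
  shows "P (p :: ncpoly)"
proof (induction p rule: basis_induct)
  case (basis k)
  have "P (basis_vec (Word u))" for u
  proof (induction u)
    case Nil
    then show ?case using assms(1) by (simp flip: zero_word_def)
  next
    case (Cons a u)
    then show ?case using assms(2,3) by (cases a) (auto simp flip: X_basis_vec Y_basis_vec)
  qed
  then show ?case by (cases k) simp
qed (use assms in auto)

lemma inj_Y: "inj ((*) Y)"
proof (rule injI)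
  fix p q :: ncpoly
  define strip where "strip = lin_ext (\<lambda>w. basis_vec (Word (tl (letters w))))"
  have "strip (Y * p) = p" for p
  proof (induction p rule: basis_induct)
    case (basis k)
    then show ?case by (cases k) (simp add: strip_def Y_basis_vec)
  qed (simp_all add: strip_def distrib_left lin_ext_add lin_ext_qscale qscale_mult_right)
  moreover assume "Y * p = Y * q"
  ultimately show "p = q" by metis
qed

lemma Ly_inv_Y [simp]: "Ly_inv (Y * p) = p"
  unfolding Ly_inv_def by (rule inv_f_f[OF inj_Y])


section \<open>The product \<open>\<diamond>\<close>\<close>

fun diamond_word :: "letter list \<Rightarrow> letter list \<Rightarrow> ncpoly" where
  "diamond_word u [] = basis_vec (Word u)"
| "diamond_word [] v = basis_vec (Word v)"
| "diamond_word (Lx # u) (Lx # v) = X * diamond_word u (Lx # v) - X * diamond_word (Ly # u) v"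
| "diamond_word (Lx # u) (Ly # v) = X * diamond_word u (Ly # v) + Y * diamond_word (Lx # u) v"
| "diamond_word (Ly # u) (Lx # v) = Y * diamond_word u (Lx # v) + X * diamond_word (Ly # u) v"
| "diamond_word (Ly # u) (Ly # v) = Y * diamond_word u (Ly # v) - Y * diamond_word (Lx # u) v"

text \<open>\<open>\<diamondop>\<close> binds weaker than multiplication and stronger than addition.\<close>

definition diamond :: "ncpoly \<Rightarrow> ncpoly \<Rightarrow> ncpoly"  (infixl \<open>\<diamondop>\<close> 68) where
  "p \<diamondop> q = lin_ext (\<lambda>u. lin_ext (\<lambda>v. diamond_word (letters u) (letters v)) q) p"

lemma diamond_add_left: "(p + p') \<diamondop> q = p \<diamondop> q + p' \<diamondop> q"
  by (simp add: diamond_def lin_ext_add)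

lemma diamond_scale_left: "qscale c p \<diamondop> q = qscale c (p \<diamondop> q)"
  by (simp add: diamond_def lin_ext_qscale)

lemma diamond_add_right: "p \<diamondop> (q + q') = p \<diamondop> q + p \<diamondop> q'"
  by (induction p rule: basis_induct)
    (simp_all add: diamond_add_left diamond_scale_left qscale.scale_right_distrib,
     simp add: diamond_def lin_ext_add)

lemma diamond_scale_right: "p \<diamondop> qscale c q = qscale c (p \<diamondop> q)"
  by (induction p rule: basis_induct)
    (simp_all add: diamond_add_left diamond_scale_left qscale.scale_right_distrib mult.commute,
     simp add: diamond_def lin_ext_qscale)

lemma diamond_diff_left: "(p - p') \<diamondop> q = p \<diamondop> q - p' \<diamondop> q"
  using diamond_add_left[of "p - p'" p' q] by (simp add: algebra_simps)

lemma diamond_diff_right: "p \<diamondop> (q - q') = p \<diamondop> q - p \<diamondop> q'"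
  using diamond_add_right[of p "q - q'" q'] by (simp add: algebra_simps)

lemmas diamond_lin = diamond_add_left diamond_scale_left diamond_add_right diamond_scale_right
  diamond_diff_left diamond_diff_right qscale_mult_left qscale_mult_right
  qscale.scale_right_distrib qscale.scale_right_diff_distrib distrib_left distrib_right
  left_diff_distrib right_diff_distrib

lemma diamond_basis_vec: "basis_vec (Word u) \<diamondop> basis_vec (Word v) = diamond_word u v"
  by (simp add: diamond_def)

lemma one_word: "(1 :: ncpoly) = basis_vec (Word [])"
  by (simp flip: zero_word_def)

lemma diamond_1_right [simp]: "w \<diamondop> 1 = w"
proof (induction w rule: basis_induct)
  case (basis k)
  show ?case by (cases k) (simp add: one_word diamond_basis_vec del: single_one)
qed (simp_all add: diamond_lin)

lemma diamond_1_left [simp]: "1 \<diamondop> w = w"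
proof (induction w rule: basis_induct)
  case (basis k)
  have "diamond_word [] v = basis_vec (Word v)" for v by (cases v) simp_all
  then show ?case by (cases k) (simp add: one_word diamond_basis_vec del: single_one)
qed (simp_all add: diamond_lin)

lemma diamond_XX: "X * p \<diamondop> X * q = X * (p \<diamondop> X * q) - X * (Y * p \<diamondop> q)"
proof (induction p rule: basis_induct)
  case (basis k)
  show ?case
  proof (induction q rule: basis_induct)
    case (basis l)
    show ?case by (cases k; cases l) (simp add: X_basis_vec Y_basis_vec diamond_basis_vec)
  qed (simp_all add: diamond_lin)
qed (simp_all add: diamond_lin)

lemma diamond_XY: "X * p \<diamondop> Y * q = X * (p \<diamondop> Y * q) + Y * (X * p \<diamondop> q)"
proof (induction p rule: basis_induct)
  case (basis k)
  show ?case
  proof (induction q rule: basis_induct)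
    case (basis l)
    show ?case by (cases k; cases l) (simp add: X_basis_vec Y_basis_vec diamond_basis_vec)
  qed (simp_all add: diamond_lin)
qed (simp_all add: diamond_lin)

lemma diamond_YX: "Y * p \<diamondop> X * q = Y * (p \<diamondop> X * q) + X * (Y * p \<diamondop> q)"
proof (induction p rule: basis_induct)
  case (basis k)
  show ?case
  proof (induction q rule: basis_induct)
    case (basis l)
    show ?case by (cases k; cases l) (simp add: X_basis_vec Y_basis_vec diamond_basis_vec)
  qed (simp_all add: diamond_lin)
qed (simp_all add: diamond_lin)

lemma diamond_YY: "Y * p \<diamondop> Y * q = Y * (p \<diamondop> Y * q) - Y * (X * p \<diamondop> q)"
proof (induction p rule: basis_induct)
  case (basis k)
  show ?case
  proof (induction q rule: basis_induct)
    case (basis l)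
    show ?case by (cases k; cases l) (simp add: X_basis_vec Y_basis_vec diamond_basis_vec)
  qed (simp_all add: diamond_lin)
qed (simp_all add: diamond_lin)

text \<open>Commutativity and associativity are checked in the generators \<open>x\<close> and \<open>z = x + y\<close>:
  multiplication by \<open>z\<close> on the left commutes with \<open>\<diamondop>\<close>.\<close>

lemma diamond_Z_left: "(X + Y) * p \<diamondop> q = (X + Y) * (p \<diamondop> q)"
  by (induction q rule: ncpoly_induct)
    (simp_all add: diamond_lin diamond_XX diamond_XY diamond_YX diamond_YY)

lemma diamond_Z_right: "p \<diamondop> (X + Y) * q = (X + Y) * (p \<diamondop> q)"
proof (induction p rule: ncpoly_induct)
  case (X p)
  have "X * p \<diamondop> (X + Y) * q = X * (p \<diamondop> (X + Y) * q) - X * (Y * p \<diamondop> q) + Y * (X * p \<diamondop> q)"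
    by (simp add: diamond_lin diamond_XX diamond_XY)
  also have "p \<diamondop> (X + Y) * q = X * p \<diamondop> q + Y * p \<diamondop> q"
    using X diamond_Z_left[of p q] by (simp add: distrib_right diamond_add_left)
  finally show ?case by (simp add: distrib_left distrib_right)
next
  case (Y p)
  have "Y * p \<diamondop> (X + Y) * q = Y * (p \<diamondop> (X + Y) * q) + X * (Y * p \<diamondop> q) - Y * (X * p \<diamondop> q)"
    by (simp add: diamond_lin diamond_YX diamond_YY)
  also have "p \<diamondop> (X + Y) * q = X * p \<diamondop> q + Y * p \<diamondop> q"
    using Y diamond_Z_left[of p q] by (simp add: distrib_right diamond_add_left)
  finally show ?case by (simp add: distrib_left distrib_right)
qed (simp_all only: diamond_1_left diamond_add_left diamond_scale_left qscale_mult_right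
       distrib_left qscale.scale_right_distrib)

lemma diamond_XX': "X * p \<diamondop> X * q =
    X * (p \<diamondop> X * q) + X * (X * p \<diamondop> q) - X * ((X + Y) * (p \<diamondop> q))"
  unfolding diamond_Z_left[symmetric] by (simp add: diamond_lin diamond_XX)

lemma ncpoly_induct_XZ [case_names one X Z add scale]:
  assumes "P 1" "\<And>p. P p \<Longrightarrow> P (X * p)" "\<And>p. P p \<Longrightarrow> P ((X + Y) * p)"
    "\<And>p q. P p \<Longrightarrow> P q \<Longrightarrow> P (p + q)" "\<And>c p. P p \<Longrightarrow> P (qscale c p)"
  shows "P (p :: ncpoly)"
proof (induction p rule: ncpoly_induct)
  case (Y p)
  have "Y * p = (X + Y) * p + qscale (- 1) (X * p)"
    by (simp add: distrib_right)
  then show ?case using Y assms by metis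
qed (use assms in auto)

lemma diamond_commute: "p \<diamondop> q = q \<diamondop> p"
proof (induction p arbitrary: q rule: ncpoly_induct_XZ)
  case (X p)
  note IH = X
  show ?case
  proof (induction q rule: ncpoly_induct_XZ)
    case (X q)
    then show ?case using IH[of q] IH[of "X * q"] by (simp add: diamond_XX' algebra_simps)
  qed (simp_all add: diamond_Z_left diamond_Z_right,
       simp_all add: diamond_add_left diamond_add_right diamond_scale_left diamond_scale_right)
qed (simp_all add: diamond_Z_left diamond_Z_right,
     simp_all add: diamond_add_left diamond_add_right diamond_scale_left diamond_scale_right)

lemma diamond_assoc: "(p \<diamondop> q) \<diamondop> r = p \<diamondop> (q \<diamondop> r)"
proof (induction p arbitrary: q r rule: ncpoly_induct_XZ)
  case (X p)
  note IHp = X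
  show ?case
  proof (induction q arbitrary: r rule: ncpoly_induct_XZ)
    case (X q)
    note IHq = X
    show ?case
    proof (induction r rule: ncpoly_induct_XZ)
      case (X r)
      let ?Z = "X + Y"
      have l: "(X * p \<diamondop> X * q) \<diamondop> X * r =
         X * ((p \<diamondop> X * q + X * p \<diamondop> q - ?Z * (p \<diamondop> q)) \<diamondop> X * r)
         + X * ((X * p \<diamondop> X * q) \<diamondop> r)
         - X * (?Z * ((p \<diamondop> X * q + X * p \<diamondop> q - ?Z * (p \<diamondop> q)) \<diamondop> r))"
        by (simp only: diamond_XX' diamond_add_left diamond_diff_left)
           (simp only: distrib_left right_diff_distrib, simp)
      have r: "X * p \<diamondop> (X * q \<diamondop> X * r) =
         X * (p \<diamondop> (X * q \<diamondop> X * r))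
         + X * (X * p \<diamondop> (q \<diamondop> X * r + X * q \<diamondop> r - ?Z * (q \<diamondop> r)))
         - X * (?Z * (p \<diamondop> (q \<diamondop> X * r + X * q \<diamondop> r - ?Z * (q \<diamondop> r))))"
        by (simp only: diamond_XX' diamond_add_right diamond_diff_right)
           (simp only: distrib_left right_diff_distrib, simp)
      show ?case
        unfolding l r X
        by (simp only: diamond_add_left diamond_diff_left diamond_add_right diamond_diff_right
              diamond_Z_left diamond_Z_right IHp IHq)
           (simp only: distrib_left right_diff_distrib, simp)
    qed (simp_all add: diamond_Z_left diamond_Z_right,
         simp_all add: diamond_add_left diamond_add_right diamond_scale_left diamond_scale_right)
  qed (simp_all add: diamond_Z_left diamond_Z_right,
       simp_all add: diamond_add_left diamond_add_right diamond_scale_left diamond_scale_right)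
qed (simp_all add: diamond_Z_left diamond_Z_right,
     simp_all add: diamond_add_left diamond_add_right diamond_scale_left diamond_scale_right)

interpretation diamond: comm_monoid_mset diamond 1
  by standard (simp_all add: diamond_assoc, rule diamond_commute)


section \<open>The Connes--Kreimer Hopf algebra\<close>

text \<open>A rooted tree is \<open>B\<^sub>+\<close> of the multiset of its branches, and a forest is a multiset of trees.
  The product of forests is the sum of multisets and the empty forest is \<open>{#}\<close>.\<close>

datatype rtree = Bplus "rtree multiset"

type_synonym forest = "rtree multiset"

type_synonym CK = "forest \<Rightarrow>\<^sub>0 rat"

text \<open>\<open>\<H> \<otimes> \<H>\<close> with basis the pairs of forests; its multiplication is componentwise on pairs.\<close>

type_synonym CK2 = "forest \<times> forest \<Rightarrow>\<^sub>0 rat"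

definition Bplus_id :: "CK2 \<Rightarrow> CK2" where
  "Bplus_id = lin_ext (\<lambda>(g, h). basis_vec ({#Bplus g#}, h))"

primrec coprod_tree :: "rtree \<Rightarrow> CK2" where
  "coprod_tree (Bplus f) =
     basis_vec ({#}, {#Bplus f#}) + Bplus_id (prod_mset (image_mset coprod_tree f))"

definition coprod_forest :: "forest \<Rightarrow> CK2" where
  "coprod_forest f = prod_mset (image_mset coprod_tree f)"

definition coproduct :: "CK \<Rightarrow> CK2" where
  "coproduct = lin_ext coprod_forest"

lemma coprod_forest_tree:
  "coprod_forest {#Bplus f#} = basis_vec ({#}, {#Bplus f#}) + Bplus_id (coprod_forest f)"
  by (simp add: coprod_forest_def)

lemma coprod_forest_empty: "coprod_forest {#} = basis_vec ({#}, {#})"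
  by (simp add: coprod_forest_def flip: zero_prod_def)

lemma coprod_forest_union: "coprod_forest (f + g) = coprod_forest f * coprod_forest g"
  by (simp add: coprod_forest_def)


section \<open>Rooted tree maps\<close>

text \<open>The defining recursion does not visibly respect \<open>f = gh = hg\<close>, so the maps are introduced as
  the unique bilinear solution of the recursion. In the last clause, \<open>lin_ext\<close> over
  \<open>coproduct (basis_vec f)\<close> is the Sweedler sum.\<close>

definition is_rooted_tree_maps :: "(CK \<Rightarrow> ncpoly \<Rightarrow> ncpoly) \<Rightarrow> bool" where
  "is_rooted_tree_maps T \<longleftrightarrow>
     (\<forall>w. Vector_Spaces.linear qscale qscale (\<lambda>f. T f w)) \<and>
     (\<forall>f. Vector_Spaces.linear qscale qscale (T f)) \<and>
     T (basis_vec {#}) = id \<and>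
     T (basis_vec {#Bplus {#}#}) X = Y * X \<and>
     T (basis_vec {#Bplus {#}#}) Y = - (Y * X) \<and>
     (\<forall>f. \<forall>u\<in>{X, Y}. f \<noteq> {#} \<longrightarrow>
        T (basis_vec {#Bplus f#}) u = Y * ((X + 2 * Y) * Ly_inv (T (basis_vec f) u))) \<and>
     (\<forall>g h. \<forall>u\<in>{X, Y}. T (basis_vec (g + h)) u = T (basis_vec g) (T (basis_vec h) u)) \<and>
     (\<forall>f w. \<forall>u\<in>{X, Y}. T (basis_vec f) (u * w) =
        lin_ext (\<lambda>(f', f''). T (basis_vec f') u * T (basis_vec f'') w) (coproduct (basis_vec f)))"

definition rooted_tree_map :: "CK \<Rightarrow> ncpoly \<Rightarrow> ncpoly" where
  "rooted_tree_map = (THE T. is_rooted_tree_maps T)"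


section \<open>The polynomials \<open>F\<close>\<close>

primrec F_tree :: "rtree \<Rightarrow> ncpoly" where
  "F_tree (Bplus f) =
     (if f = {#} then Y else Y * ((X + 2 * Y) * Ly_inv (diamond.F (image_mset F_tree f))))"

definition F_forest :: "forest \<Rightarrow> ncpoly" where
  "F_forest f = diamond.F (image_mset F_tree f)"

definition F_poly :: "CK \<Rightarrow> ncpoly" where
  "F_poly = lin_ext F_forest"

lemma F_forest_empty: "F_forest {#} = 1"
  by (simp add: F_forest_def)

lemma F_forest_vertex: "F_forest {#Bplus {#}#} = Y"
  by (simp add: F_forest_def)

lemma F_forest_tree:
  "f \<noteq> {#} \<Longrightarrow> F_forest {#Bplus f#} = Y * ((X + 2 * Y) * Ly_inv (F_forest f))"
  by (simp add: F_forest_def)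

lemma F_forest_union: "F_forest (g + h) = F_forest g \<diamondop> F_forest h"
  by (simp add: F_forest_def diamond.union)

lemma F_forest_in_range_Y: "f \<noteq> {#} \<Longrightarrow> F_forest f \<in> range ((*) Y)"
proof (induction f)
  case (add t f)
  have t: "F_forest {#t#} \<in> range ((*) Y)"
    by (cases t) (auto simp: F_forest_def image_iff intro: exI[of _ 1])
  show ?case
  proof (cases "f = {#}")
    case False
    then obtain p q where "F_forest {#t#} = Y * p" "F_forest f = Y * q"
      using t add by auto
    then have "F_forest ({#t#} + f) = Y * (p \<diamondop> Y * q - X * p \<diamondop> q)"
      by (simp only: F_forest_union diamond_YY right_diff_distrib)
    then show ?thesis by simp
  qed (use t in simp)
qed simp

end

theory Submission
  imports Defs
begin

text \<open>Every nonempty forest kills \<open>z = x + y\<close>, so the rooted tree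
  maps commute with right multiplication by \<open>z\<close>. Together with the asserted formula this determines
  them on \<open>\<A> = \<rat> \<oplus> \<A>x \<oplus> \<A>z\<close>, and the maps so obtained are taken as the candidate solution of the
  recursion. Multiplicativity is then associativity of \<open>\<diamondop>\<close>, and the rule for \<open>uw\<close> reduces to
  \<open>F\<^sub>f \<diamondop> vxw = \<Sum> (F\<^sub>f\<^sub>' \<diamondop> v) x (F\<^sub>f\<^sub>'\<^sub>' \<diamondop> w)\<close>, which is proved by induction on \<open>f\<close>.
  Since the solution of the recursion is unique, the candidate is the family of rooted tree maps.\<close>

section \<open>Sweedler sums\<close>

text \<open>\<open>G\<close> is evaluated only at pairs of forests, so it may branch on conditions
  such as \<open>a = {#}\<close>; this is how the counit enters the sums.\<close>

definition sweedler :: "(forest \<Rightarrow> forest \<Rightarrow> 'k \<Rightarrow>\<^sub>0 rat) \<Rightarrow> forest \<Rightarrow> 'k \<Rightarrow>\<^sub>0 rat" where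
  "sweedler G f = lin_ext (\<lambda>(a, b). G a b) (coprod_forest f)"

lemma lin_ext_push:
  assumes "\<And>p q. \<phi> (p + q) = \<phi> p + \<phi> q" "\<And>c p. \<phi> (qscale c p) = qscale c (\<phi> p)"
  shows "\<phi> (lin_ext g p) = lin_ext (\<lambda>k. \<phi> (g k)) p"
  by (induction p rule: basis_induct) (simp_all add: assms lin_ext_add lin_ext_qscale)

lemma lin_ext_fun_add: "lin_ext (\<lambda>k. g k + h k) p = lin_ext g p + lin_ext h p"
  by (simp add: lin_ext_def qscale.scale_right_distrib sum.distrib)

lemma lin_ext_fun_scale: "lin_ext (\<lambda>k. qscale c (g k)) p = qscale c (lin_ext g p)"
  by (simp add: lin_ext_def qscale.scale_sum_right mult.commute)

lemma lin_ext_fun_diff: "lin_ext (\<lambda>k. g k - h k) p = lin_ext g p - lin_ext h p"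
  by (simp add: lin_ext_def qscale.scale_right_diff_distrib sum_subtractf)

lemma lin_ext_mult:
  "lin_ext g (p * q) = lin_ext (\<lambda>k. lin_ext (\<lambda>l. g (k + l)) q) p"
proof (induction p rule: basis_induct)
  case (basis k)
  show ?case
    by (induction q rule: basis_induct)
      (simp_all add: mult_single distrib_left lin_ext_add lin_ext_qscale qscale_mult_right)
qed (simp_all add: distrib_right lin_ext_add lin_ext_qscale qscale_mult_left)

lemma lin_ext_Bplus_id: "lin_ext g (Bplus_id p) = lin_ext (\<lambda>(a, b). g ({#Bplus a#}, b)) p"
  by (induction p rule: basis_induct)
    (simp_all add: Bplus_id_def lin_ext_add lin_ext_qscale split: prod.split)

lemma sweedler_push:
  assumes "\<And>p q. \<phi> (p + q) = \<phi> p + \<phi> q" "\<And>c p. \<phi> (qscale c p) = qscale c (\<phi> p)"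
  shows "\<phi> (sweedler G f) = sweedler (\<lambda>a b. \<phi> (G a b)) f"
  unfolding sweedler_def by (subst lin_ext_push[of \<phi>, OF assms]) (simp add: case_prod_unfold)

lemma sweedler_add: "sweedler (\<lambda>a b. G a b + H a b) f = sweedler G f + sweedler H f"
  unfolding sweedler_def by (simp add: case_prod_unfold lin_ext_fun_add)

lemma sweedler_diff: "sweedler (\<lambda>a b. G a b - H a b) f = sweedler G f - sweedler H f"
  unfolding sweedler_def by (simp add: case_prod_unfold lin_ext_fun_diff)

lemma sweedler_scale: "sweedler (\<lambda>a b. qscale c (G a b)) f = qscale c (sweedler G f)"
  unfolding sweedler_def by (simp add: case_prod_unfold lin_ext_fun_scale)

lemma sweedler_mult_left: "p * sweedler G f = sweedler (\<lambda>a b. p * G a b) f"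
  by (rule sweedler_push) (simp_all add: distrib_left qscale_mult_right)

lemma sweedler_mult_right: "sweedler G f * p = sweedler (\<lambda>a b. G a b * p) f"
  by (rule sweedler_push[where \<phi> = "\<lambda>q. q * p"]) (simp_all add: distrib_right qscale_mult_left)

lemma sweedler_empty [simp]: "sweedler G {#} = G {#} {#}"
  by (simp add: sweedler_def coprod_forest_empty)

lemma sweedler_tree:
  "sweedler G {#Bplus f#} = G {#} {#Bplus f#} + sweedler (\<lambda>a b. G {#Bplus a#} b) f"
  by (simp add: sweedler_def coprod_forest_tree lin_ext_add lin_ext_Bplus_id)

lemma sweedler_union:
  "sweedler G (f + g) = sweedler (\<lambda>a b. sweedler (\<lambda>c d. G (a + c) (b + d)) g) f"
  by (simp add: sweedler_def coprod_forest_union lin_ext_mult case_prod_unfold)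

text \<open>The cases match the recursions of \<open>coprod_forest\<close> and
  \<open>F_forest\<close>. Structural induction on trees settles single trees: the claim for the
  branches of \<open>Bplus f\<close> gives \<open>P f\<close> by adding one tree at a time.\<close>

lemma forest_induct [case_names empty tree union]:
  assumes "P {#}" "\<And>f. P f \<Longrightarrow> P {#Bplus f#}" "\<And>f g. P f \<Longrightarrow> P g \<Longrightarrow> P (f + g)"
  shows "P (f :: forest)"
proof -
  have *: "P f" if "\<And>t. t \<in># f \<Longrightarrow> P {#t#}" for f
    using that
  proof (induction f)
    case (add t f)
    have "P ({#t#} + f)" by (intro assms add) (use add in auto)
    then show ?case by simp
  qed (rule assms)
  have "P {#t#}" for t
    by (induction t) (metis * assms(2))
  then show ?thesis by (rule *)
qed

section \<open>Counit laws of the coproduct\<close>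

lemma sweedler_zero [simp]: "sweedler (\<lambda>a b. 0) f = 0"
  by (simp add: sweedler_def lin_ext_def)

text \<open>This is (\<epsilon> \<otimes> id)\<Delta> = id, with \<epsilon> the coefficient of the
  empty forest. \<open>G\<close> stays general because the product case applies the hypothesis for
  \<open>f\<close> to the inner sum over \<open>g\<close>.\<close>

lemma sweedler_counit_left: "sweedler (\<lambda>a b. if a = {#} then G b else 0) f = G f"
proof (induction f arbitrary: G rule: forest_induct)
  case (union f g)
  have "sweedler (\<lambda>a b. if a = {#} then G b else 0) (f + g) =
      sweedler (\<lambda>a b. if a = {#} then sweedler (\<lambda>c d. if c = {#} then G (b + d) else 0) g else 0) f"
    unfolding sweedler_union by (intro arg_cong[where f = "\<lambda>H. sweedler H f"] ext) simp
  then show ?case by (simp only: union)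
qed (simp_all add: sweedler_tree)

lemma sweedler_counit_right: "sweedler (\<lambda>a b. if b = {#} then G a else 0) f = G f"
proof (induction f arbitrary: G rule: forest_induct)
  case (union f g)
  have "sweedler (\<lambda>a b. if b = {#} then G a else 0) (f + g) =
      sweedler (\<lambda>a b. if b = {#} then sweedler (\<lambda>c d. if d = {#} then G (a + c) else 0) g else 0) f"
    unfolding sweedler_union by (intro arg_cong[where f = "\<lambda>H. sweedler H f"] ext) simp
  then show ?case by (simp only: union)
qed (simp_all add: sweedler_tree)

section \<open>Grading by the number of vertices\<close>

primrec tree_order :: "rtree \<Rightarrow> nat" where
  "tree_order (Bplus f) = Suc (sum_mset (image_mset tree_order f))"

definition forest_order :: "forest \<Rightarrow> nat" where
  "forest_order f = sum_mset (image_mset tree_order f)"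

lemma forest_order_empty [simp]: "forest_order {#} = 0"
  and forest_order_union [simp]: "forest_order (f + g) = forest_order f + forest_order g"
  and forest_order_tree [simp]: "forest_order {#Bplus f#} = Suc (forest_order f)"
  by (simp_all add: forest_order_def)

lemma tree_order_pos: "tree_order t > 0"
  by (cases t) simp

lemma forest_order_eq_0_iff [simp]: "forest_order f = 0 \<longleftrightarrow> f = {#}"
  using tree_order_pos by (cases f) (auto simp: forest_order_def)

text \<open>The coproduct is homogeneous for the number of vertices, so the sum sees
  \<open>G\<close> only at pairs whose orders add up to that of \<open>f\<close>.\<close>

lemma sweedler_cong:
  assumes "\<And>a b. forest_order a + forest_order b = forest_order f \<Longrightarrow> G a b = H a b"
  shows "sweedler G f = sweedler H f"
  using assms
proof (induction f arbitrary: G H rule: forest_induct)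
  case (tree f)
  then show ?case unfolding sweedler_tree by (intro arg_cong2[where f = plus] tree(1)) simp_all
next
  case (union f g)
  show ?case unfolding sweedler_union by (intro union(1) union(2) union(3)) simp
qed simp


section \<open>Grafting and the product \<open>\<diamondop>\<close>\<close>

text \<open>\<^const>\<open>Ly_inv\<close> is not linear outside \<open>y\<A>\<close>; dropping the first letter is a linear substitute.\<close>

definition drop_first :: "ncpoly \<Rightarrow> ncpoly" where
  "drop_first = lin_ext (\<lambda>w. basis_vec (Word (tl (letters w))))"

lemma drop_first_Y [simp]: "drop_first (Y * p) = p"
proof (induction p rule: basis_induct)
  case (basis k)
  then show ?case by (cases k) (simp add: drop_first_def Y_basis_vec)
qed (simp_all add: drop_first_def distrib_left lin_ext_add lin_ext_qscale qscale_mult_right)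

lemma drop_first_X [simp]: "drop_first (X * p) = p"
proof (induction p rule: basis_induct)
  case (basis k)
  then show ?case by (cases k) (simp add: drop_first_def X_basis_vec)
qed (simp_all add: drop_first_def distrib_left lin_ext_add lin_ext_qscale qscale_mult_right)

text \<open>On y\<A> this is the operator L_y L_{x+2y} L_y^{-1} attached to B_+; being linear
  everywhere, it can be moved through Sweedler sums.\<close>

definition graft :: "ncpoly \<Rightarrow> ncpoly" where
  "graft p = Y * ((X + 2 * Y) * drop_first p)"

lemma graft_add: "graft (p + q) = graft p + graft q"
  and graft_scale: "graft (qscale c p) = qscale c (graft p)"
  by (simp_all add: graft_def drop_first_def lin_ext_add lin_ext_qscale qscale_mult_right distrib_left)

lemma graft_0 [simp]: "graft 0 = 0"
  by (simp add: graft_def drop_first_def lin_ext_def)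

text \<open>The factor x + 2y is split as z + y because left multiplication by z commutes with
  \<diamondop>.\<close>

lemma graft_Y: "graft (Y * p) = Y * ((X + Y) * p) + Y * (Y * p)"
  by (simp add: graft_def algebra_simps mult_2)

text \<open>Every word of \<open>p\<close> has a first letter, so dropping it does not touch
  \<open>q\<close>. At p = 1 the rule fails, which makes the empty forest a special case
  below.\<close>

lemma graft_mult_right: "p \<in> range ((*) Y) \<Longrightarrow> graft (p * q) = graft p * q"
  by (auto simp: graft_def mult.assoc)

section \<open>The products F_t \<diamondop> xw for a tree t\<close>

lemma F_forest_Bplus: "F_forest {#Bplus f#} = (if f = {#} then Y else graft (F_forest f))"
proof (cases "f = {#}")
  case False
  then obtain p where "F_forest f = Y * p" using F_forest_in_range_Y by blast
  then show ?thesis using False by (simp add: F_forest_tree graft_def)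
qed (simp add: F_forest_vertex)

lemma diamond_Y_X: "Y * p \<diamondop> X * w - X * (Y * p \<diamondop> w) = Y * (p \<diamondop> X * w)"
  by (simp add: diamond_YX)

text \<open>For F_f = yp the difference is y(p \<diamondop> xw), and for the empty forest it is 0.
  Grafting is therefore right linear on it.\<close>

lemma F_forest_diamond_X_range:
  "F_forest f \<diamondop> X * w - X * (F_forest f \<diamondop> w) \<in> range ((*) Y)"
proof (cases "f = {#}")
  case True
  have "Y * 0 \<in> range ((*) Y)" by (rule rangeI)
  then show ?thesis using True by (simp add: F_forest_empty)
next
  case False
  then obtain p where "F_forest f = Y * p" using F_forest_in_range_Y by blast
  then show ?thesis by (simp add: diamond_Y_X)
qed

text \<open>Let t = B_+(f). For F_f = yp one has F_t = yL with L = zp + yp. The rule for yL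
  \<diamondop> xw leaves L \<diamondop> xw, where z moves out of the product and yp \<diamondop> xw
  is expanded once more. For the empty forest the grafted term vanishes and the rule for y
  \<diamondop> xw remains.\<close>

lemma F_forest_Bplus_diamond_X:
  "F_forest {#Bplus f#} \<diamondop> X * w =
     X * (F_forest {#Bplus f#} \<diamondop> w) + graft (F_forest f \<diamondop> X * w - X * (F_forest f \<diamondop> w))
     + Y * (X * (F_forest f \<diamondop> w))"
proof (cases "f = {#}")
  case True
  then show ?thesis
    using diamond_YX[of 1 w] by (simp add: F_forest_vertex F_forest_empty algebra_simps)
next
  case False
  then obtain p where p: "F_forest f = Y * p" using F_forest_in_range_Y by blast
  let ?L = "(X + Y) * p + Y * p"
  have g: "graft (Y * p) = Y * ?L" by (simp add: graft_Y distrib_left)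
  have "Y * ?L \<diamondop> X * w = Y * (?L \<diamondop> X * w) + X * (Y * ?L \<diamondop> w)"
    by (rule diamond_YX)
  also have "?L \<diamondop> X * w = (X + Y) * (p \<diamondop> X * w) + (Y * (p \<diamondop> X * w) + X * (Y * p \<diamondop> w))"
    by (simp only: diamond_add_left diamond_Z_left diamond_YX)
  finally show ?thesis
    using False unfolding F_forest_Bplus p
    by (simp add: g diamond_Y_X) (simp add: graft_Y algebra_simps)
qed

text \<open>The conditional terms are the summands of the counit expansion of \<open>x(F\<^sub>f \<diamondop> w)\<close>, split off
  since only nonempty forests have \<open>F\<^sub>a \<in> y\<A>\<close>, where grafting is right linear.\<close>

lemma F_forest_Bplus_one:
  "F_forest {#Bplus a#} * X * r =
     graft (F_forest a * X * r - (if a = {#} then X * r else 0)) + (if a = {#} then Y * (X * r) else 0)"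
  using graft_mult_right[OF F_forest_in_range_Y, of a "X * r"]
  by (simp add: F_forest_Bplus F_forest_empty mult.assoc)

text \<open>The middle letter x separates the two tensor factors of the coproduct. \<open>v\<close>
  and \<open>w\<close> vary because the product case applies the hypothesis for \<open>g\<close> to
  F_a \<diamondop> v and F_b \<diamondop> w in every summand of the one for
  \<open>f\<close>.\<close>

lemma F_forest_diamond_X:
  "F_forest f \<diamondop> v * X * w = sweedler (\<lambda>a b. (F_forest a \<diamondop> v) * X * (F_forest b \<diamondop> w)) f"
proof (induction f arbitrary: v w rule: forest_induct)
  case empty
  then show ?case by (simp add: F_forest_empty)
next
  case (union f g)
  have F: "F_forest (a + c) \<diamondop> u = F_forest c \<diamondop> (F_forest a \<diamondop> u)" for a c u
    by (simp add: F_forest_union diamond_commute[of "F_forest a"] diamond_assoc)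
  have "F_forest (f + g) \<diamondop> v * X * w = F_forest g \<diamondop> (F_forest f \<diamondop> v * X * w)"
    by (rule F)
  also have "\<dots> = sweedler (\<lambda>a b. F_forest g \<diamondop> (F_forest a \<diamondop> v) * X * (F_forest b \<diamondop> w)) f"
    unfolding union(1) by (rule sweedler_push) (simp_all add: diamond_add_right diamond_scale_right)
  also have "\<dots> = sweedler (\<lambda>a b. sweedler (\<lambda>c d.
       (F_forest (a + c) \<diamondop> v) * X * (F_forest (b + d) \<diamondop> w)) g) f"
    unfolding union(2) F ..
  finally show ?case by (simp only: sweedler_union)
next
  case (tree f)
  let ?t = "{#Bplus f#}"
  \<comment> \<open>Inner induction on v in the left generators: x is handled by the recursion for
    F_t \<diamondop> xw, and z commutes with \<diamondop>. The outer hypothesis for \<open>f\<close>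
    stays available for all v and w.\<close>
  show ?case unfolding sweedler_tree
  proof (induction v rule: ncpoly_induct_XZ)
    case one
    let ?A = "\<lambda>a b. F_forest a * X * (F_forest b \<diamondop> w)"
    let ?E = "\<lambda>a b. if a = {#} then X * (F_forest b \<diamondop> w) else 0"
    have "F_forest f \<diamondop> X * w - X * (F_forest f \<diamondop> w) = sweedler (\<lambda>a b. ?A a b - ?E a b) f"
      using tree[of 1 w] by (simp add: sweedler_diff sweedler_counit_left)
    then have "graft (F_forest f \<diamondop> X * w - X * (F_forest f \<diamondop> w)) =
        sweedler (\<lambda>a b. graft (?A a b - ?E a b)) f"
      using sweedler_push[where \<phi> = graft, OF graft_add graft_scale] by simp
    moreover have "Y * (X * (F_forest f \<diamondop> w)) =
        sweedler (\<lambda>a b. if a = {#} then Y * (X * (F_forest b \<diamondop> w)) else 0) f"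
      by (simp add: sweedler_counit_left)
    ultimately show ?case
      by (simp only: mult_1_left F_forest_Bplus_diamond_X diamond_1_right F_forest_Bplus_one
          sweedler_add F_forest_empty diamond_1_left add.assoc)
  next
    case (X v)
    let ?S = "\<lambda>v. sweedler (\<lambda>a b. (F_forest a \<diamondop> v) * X * (F_forest b \<diamondop> w)) f"
    let ?D = "\<lambda>a. F_forest a \<diamondop> X * v - X * (F_forest a \<diamondop> v)"
    have S: "F_forest f \<diamondop> v * X * w = ?S v" "F_forest f \<diamondop> X * (v * X * w) = ?S (X * v)"
      using tree[of v w] tree[of "X * v" w] by (simp_all add: mult.assoc)
    have "F_forest {#Bplus f#} \<diamondop> X * v * X * w =
        X * (F_forest {#Bplus f#} \<diamondop> v * X * w) + graft (?S (X * v) - X * ?S v) + Y * (X * ?S v)"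
      using F_forest_Bplus_diamond_X[of f "v * X * w"] unfolding S by (simp add: mult.assoc)
    also have "?S (X * v) - X * ?S v = sweedler (\<lambda>a b. ?D a * X * (F_forest b \<diamondop> w)) f"
      by (simp add: left_diff_distrib sweedler_diff sweedler_mult_left mult.assoc)
    \<comment> \<open>Every \<open>?D a\<close> lies in y\<A>, so \<open>graft\<close> acts on the
      left factor alone.\<close>
    also have "graft \<dots> = sweedler (\<lambda>a b. graft (?D a) * X * (F_forest b \<diamondop> w)) f"
      by (simp add: sweedler_push[where \<phi> = graft, OF graft_add graft_scale] mult.assoc
          graft_mult_right[OF F_forest_diamond_X_range])
    \<comment> \<open>The same recursion, applied to each left factor F_{B_+(a)} \<diamondop> xv,
      makes both sides agree; the inner hypothesis supplies the term x(F_t \<diamondop>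
      vxw).\<close>
    finally show ?case
      unfolding X by (simp add: F_forest_Bplus_diamond_X[where w = v] distrib_left distrib_right sweedler_add
          sweedler_mult_left F_forest_empty mult.assoc)
  next
    case (Z v)
    then show ?case
      by (simp only: mult.assoc diamond_Z_right distrib_left sweedler_mult_left)
  next
    case (add p q)
    then show ?case
      by (simp add: distrib_right diamond_add_right sweedler_add)
  next
    case (scale c p)
    then show ?case
      by (simp add: qscale_mult_left diamond_scale_right sweedler_scale qscale.scale_right_distrib)
  qed
qed


section \<open>Existence of the rooted tree maps\<close>

lemma basis_vec_mult_X: "basis_vec (Word u) * X = basis_vec (Word (u @ [Lx]))"
  and basis_vec_mult_Y: "basis_vec (Word u) * Y = basis_vec (Word (u @ [Ly]))"
  by (simp_all add: X_def Y_def mult_single plus_word_def)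

text \<open>Words are read from the right, a last letter y being written as z - x. The x case has no
  hypothesis since the candidate maps have a closed formula on \<A>x.\<close>

lemma ncpoly_induct_right [case_names one X Z add scale]:
  assumes "P 1" "\<And>p. P (p * X)" "\<And>p. P p \<Longrightarrow> P (p * (X + Y))"
    "\<And>p q. P p \<Longrightarrow> P q \<Longrightarrow> P (p + q)" "\<And>c p. P p \<Longrightarrow> P (qscale c p)"
  shows "P (p :: ncpoly)"
proof (induction p rule: basis_induct)
  case (basis k)
  have "P (basis_vec (Word u))" for u
  proof (induction u rule: rev_induct)
    case Nil
    then show ?case using assms(1) by (simp flip: zero_word_def)
  next
    case (snoc a u)
    show ?case
    proof (cases a)
      case Lx
      then show ?thesis using assms(2) by (metis basis_vec_mult_X)
    next
      case Ly
      let ?u = "basis_vec (Word u)"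
      have "basis_vec (Word (u @ [a])) = ?u * (X + Y) + qscale (- 1) (?u * X)"
        by (simp add: Ly distrib_left basis_vec_mult_Y)
      then show ?thesis using assms snoc by metis
    qed
  qed
  then show ?case by (cases k) simp
qed (use assms in auto)

text \<open>The list is the word reversed, so its last letter comes first. On 1 the value is the
  counit, on wx it is the asserted formula, and y = z - x turns wy into the image of w times z minus
  the image of wx.\<close>

fun tree_map_word :: "forest \<Rightarrow> letter list \<Rightarrow> ncpoly" where
  "tree_map_word f [] = (if f = {#} then 1 else 0)"
| "tree_map_word f (Lx # u) = (F_forest f \<diamondop> basis_vec (Word (rev u))) * X"
| "tree_map_word f (Ly # u) =
     tree_map_word f u * (X + Y) - (F_forest f \<diamondop> basis_vec (Word (rev u))) * X"

definition tree_map :: "forest \<Rightarrow> ncpoly \<Rightarrow> ncpoly" where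
  "tree_map f = lin_ext (\<lambda>u. tree_map_word f (rev (letters u)))"

section \<open>Values of the candidate maps on letters, and their multiplicativity\<close>

lemma tree_map_add: "tree_map f (p + q) = tree_map f p + tree_map f q"
  and tree_map_scale: "tree_map f (qscale c p) = qscale c (tree_map f p)"
  by (simp_all add: tree_map_def lin_ext_add lin_ext_qscale)

lemma tree_map_0 [simp]: "tree_map f 0 = 0"
  by (simp add: tree_map_def lin_ext_def)

lemma tree_map_1: "tree_map f 1 = (if f = {#} then 1 else 0)"
  by (simp add: tree_map_def one_word del: single_one)

lemma tree_map_mult_X: "tree_map f (w * X) = (F_forest f \<diamondop> w) * X"
proof (induction w rule: basis_induct)
  case (basis k)
  then show ?case by (cases k) (simp add: basis_vec_mult_X, simp add: tree_map_def)
qed (simp_all add: distrib_right qscale_mult_left diamond_add_right diamond_scale_right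
    tree_map_add tree_map_scale)

lemma tree_map_mult_Z: "tree_map f (w * (X + Y)) = tree_map f w * (X + Y)"
proof (induction w rule: basis_induct)
  case (basis k)
  obtain u where k: "k = Word u" by (cases k)
  have "tree_map f (basis_vec (Word u) * Y) =
      tree_map f (basis_vec (Word u)) * (X + Y) - (F_forest f \<diamondop> basis_vec (Word u)) * X"
    unfolding basis_vec_mult_Y by (simp add: tree_map_def)
  then show ?case unfolding k by (simp only: distrib_left[of "basis_vec (Word u)"] tree_map_add
      tree_map_mult_X) simp
qed (simp_all only: distrib_right[of _ _ "X + Y"] qscale_mult_left tree_map_add tree_map_scale)

lemma tree_map_X: "tree_map f X = F_forest f * X"
  using tree_map_mult_X[of f 1] by simp

lemma tree_map_Z: "tree_map f (X + Y) = (if f = {#} then X + Y else 0)"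
  using tree_map_mult_Z[of f 1] by (simp add: tree_map_1)

lemma tree_map_Y: "tree_map f Y = (if f = {#} then Y else - (F_forest f * X))"
  using tree_map_Z[of f] by (auto simp: tree_map_add tree_map_X F_forest_empty eq_neg_iff_add_eq_0 add.commute)

lemma tree_map_empty: "tree_map {#} w = w"
  by (induction w rule: ncpoly_induct_right)
    (simp_all only: tree_map_1 tree_map_mult_X tree_map_mult_Z tree_map_add tree_map_scale
      F_forest_empty diamond_1_left if_True simp_thms)

lemma tree_map_union: "tree_map (g + h) w = tree_map g (tree_map h w)"
proof (induction w rule: ncpoly_induct_right)
  case one
  then show ?case by (auto simp: tree_map_1)
qed (simp_all only: tree_map_mult_X tree_map_mult_Z tree_map_add tree_map_scale
      F_forest_union diamond_assoc)

text \<open>The letter y is traded for z: by \<open>tree_map_Z\<close> only the empty left factor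
  survives, so for u = z the sum collapses by the left counit law. Induction runs on the right end
  of w: w = 1 is the right counit law, and u = x with last letter x is
  \<open>F_forest_diamond_X\<close> at v = 1.\<close>

lemma tree_map_mult:
  assumes "u \<in> {X, X + Y}"
  shows "tree_map f (u * w) = sweedler (\<lambda>a b. tree_map a u * tree_map b w) f"
proof (induction w rule: ncpoly_induct_right)
  case one
  have "sweedler (\<lambda>a b. tree_map a u * tree_map b 1) f =
      sweedler (\<lambda>a b. if b = {#} then tree_map a u else 0) f"
    by (intro arg_cong[where f = "\<lambda>H. sweedler H f"] ext) (simp add: tree_map_1)
  then show ?case by (simp add: sweedler_counit_right)
next
  case (X w)
  consider "u = X" | "u = X + Y" using assms by blast
  then show ?case
  proof cases
    case 1
    have "tree_map f (X * (w * X)) = (F_forest f \<diamondop> 1 * X * w) * X"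
      using tree_map_mult_X[of f "X * w"] by (simp add: mult.assoc)
    then show ?thesis
      unfolding 1 F_forest_diamond_X
      by (simp add: tree_map_X tree_map_mult_X sweedler_mult_right mult.assoc)
  next
    case 2
    have "tree_map f ((X + Y) * (w * X)) = (X + Y) * ((F_forest f \<diamondop> w) * X)"
      using tree_map_mult_X[of f "(X + Y) * w"] by (simp only: mult.assoc diamond_Z_right)
    also have "\<dots> = sweedler (\<lambda>a b. if a = {#} then (X + Y) * ((F_forest b \<diamondop> w) * X) else 0) f"
      by (simp only: sweedler_counit_left)
    also have "\<dots> = sweedler (\<lambda>a b. tree_map a (X + Y) * tree_map b (w * X)) f"
      by (intro arg_cong[where f = "\<lambda>H. sweedler H f"] ext) (simp add: tree_map_Z tree_map_mult_X)
    finally show ?thesis unfolding 2 .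
  qed
next
  case (Z w)
  then show ?case
    by (simp only: tree_map_mult_Z sweedler_mult_right flip: mult.assoc)
next
  case (add p q)
  then show ?case by (simp add: tree_map_add distrib_left sweedler_add)
next
  case (scale c p)
  then show ?case by (simp add: tree_map_scale qscale_mult_right sweedler_scale)
qed

lemma tree_map_mult_letter:
  assumes "u \<in> {X, Y}"
  shows "tree_map f (u * w) = sweedler (\<lambda>a b. tree_map a u * tree_map b w) f"
proof (cases "u = X")
  case False
  have "tree_map f (Y * w) = tree_map f ((X + Y) * w) - tree_map f (X * w)"
    by (simp add: distrib_right tree_map_add)
  also have "\<dots> = sweedler (\<lambda>a b. (tree_map a (X + Y) - tree_map a X) * tree_map b w) f"
    by (simp only: tree_map_mult insert_iff simp_thms left_diff_distrib sweedler_diff)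
  also have "(\<lambda>a b. (tree_map a (X + Y) - tree_map a X) * tree_map b w) =
      (\<lambda>a b. tree_map a Y * tree_map b w)"
    by (intro ext) (simp add: tree_map_add)
  finally show ?thesis using assms False by simp
qed (simp add: tree_map_mult)

text \<open>Both letters go to plus or minus F_f x with F_f = yp, so \<open>Ly_inv\<close> is
  applied inside y\<A> and removes the leading y.\<close>

lemma tree_map_Bplus:
  assumes "f \<noteq> {#}" "u \<in> {X, Y}"
  shows "tree_map {#Bplus f#} u = Y * ((X + 2 * Y) * Ly_inv (tree_map f u))"
proof -
  obtain p where p: "F_forest f = Y * p" using F_forest_in_range_Y[OF assms(1)] by blast
  have "tree_map f u = Y * (p * (if u = X then X else - X))"
    using assms p by (auto simp: tree_map_X tree_map_Y mult.assoc)
  moreover have "tree_map {#Bplus f#} u = Y * ((X + 2 * Y) * (p * (if u = X then X else - X)))"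
    using assms p by (auto simp: tree_map_X tree_map_Y F_forest_tree mult.assoc)
  ultimately show ?thesis by simp
qed

lemma linear_qscaleI:
  assumes "\<And>p q. \<phi> (p + q) = \<phi> p + \<phi> q" "\<And>c p. \<phi> (qscale c p) = qscale c (\<phi> p)"
  shows "Vector_Spaces.linear qscale qscale \<phi>"
  by standard (simp_all add: assms)

lemma is_rooted_tree_maps_tree_map:
  "is_rooted_tree_maps (\<lambda>p w. lin_ext (\<lambda>f. tree_map f w) p)"
  unfolding is_rooted_tree_maps_def
proof (intro conjI allI ballI impI)
  show "Vector_Spaces.linear qscale qscale (\<lambda>w. lin_ext (\<lambda>f. tree_map f w) p)" for p
    by (intro linear_qscaleI)
      (simp_all add: tree_map_add tree_map_scale lin_ext_fun_add lin_ext_fun_scale)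
next
  fix f :: forest and u assume "f \<noteq> {#}" "u \<in> {X, Y}"
  then show "lin_ext (\<lambda>f. tree_map f u) (basis_vec {#Bplus f#}) =
      Y * ((X + 2 * Y) * Ly_inv (lin_ext (\<lambda>f. tree_map f u) (basis_vec f)))"
    unfolding lin_ext_basis_vec by (rule tree_map_Bplus)
next
  fix f :: forest and u w assume "u \<in> {X, Y}"
  then show "lin_ext (\<lambda>f. tree_map f (u * w)) (basis_vec f) =
      lin_ext (\<lambda>(f', f''). lin_ext (\<lambda>f. tree_map f u) (basis_vec f')
        * lin_ext (\<lambda>f. tree_map f w) (basis_vec f'')) (coproduct (basis_vec f))"
    unfolding lin_ext_basis_vec coproduct_def sweedler_def[symmetric] by (rule tree_map_mult_letter)
next
  show "(\<lambda>w. lin_ext (\<lambda>f. tree_map f w) (basis_vec {#})) = id"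
    unfolding lin_ext_basis_vec by (auto simp: tree_map_empty)
qed (simp_all only: linear_lin_ext lin_ext_basis_vec tree_map_union,
     simp_all add: tree_map_X tree_map_Y F_forest_vertex)


section \<open>Uniqueness of the rooted tree maps\<close>

lemma is_rooted_tree_mapsD:
  assumes "is_rooted_tree_maps T"
  shows "T (p + p') w = T p w + T p' w" "T (qscale c p) w = qscale c (T p w)"
    "T p (w + w') = T p w + T p w'" "T p (qscale c w) = qscale c (T p w)"
    "T (basis_vec {#}) = id"
    "T (basis_vec {#Bplus {#}#}) X = Y * X" "T (basis_vec {#Bplus {#}#}) Y = - (Y * X)"
    "f \<noteq> {#} \<Longrightarrow> u \<in> {X, Y} \<Longrightarrow>
       T (basis_vec {#Bplus f#}) u = Y * ((X + 2 * Y) * Ly_inv (T (basis_vec f) u))"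
    "u \<in> {X, Y} \<Longrightarrow> T (basis_vec (g + h)) u = T (basis_vec g) (T (basis_vec h) u)"
    "u \<in> {X, Y} \<Longrightarrow> T (basis_vec f) (u * w) =
       sweedler (\<lambda>a b. T (basis_vec a) u * T (basis_vec b) w) f"
proof -
  have 1: "Vector_Spaces.linear qscale qscale (\<lambda>f. T f w)" for w
    using assms by (simp add: is_rooted_tree_maps_def)
  have 2: "Vector_Spaces.linear qscale qscale (T f)" for f
    using assms by (simp add: is_rooted_tree_maps_def)
  show "T (p + p') w = T p w + T p' w" "T (qscale c p) w = qscale c (T p w)"
    using module_hom.add[OF Vector_Spaces.linear.axioms(3)[OF 1]] module_hom.scale[OF Vector_Spaces.linear.axioms(3)[OF 1]] by auto
  show "T p (w + w') = T p w + T p w'" "T p (qscale c w) = qscale c (T p w)"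
    using module_hom.add[OF Vector_Spaces.linear.axioms(3)[OF 2]] module_hom.scale[OF Vector_Spaces.linear.axioms(3)[OF 2]] by auto
qed (use assms[unfolded is_rooted_tree_maps_def coproduct_def lin_ext_basis_vec, folded sweedler_def]
      in blast)+

text \<open>Induction on the number of vertices. At order n the letters come first, from smaller
  forests; words follow letter by letter by homogeneity of the coproduct; the value at 1, which no
  clause prescribes for nonempty forests, is recovered by cancellation.\<close>

lemma is_rooted_tree_maps_unique:
  assumes T: "is_rooted_tree_maps T" and T': "is_rooted_tree_maps T'"
  shows "T = T'"
proof -
  note D = is_rooted_tree_mapsD[OF T] and D' = is_rooted_tree_mapsD[OF T']
  have basis: "T (basis_vec f) w = T' (basis_vec f) w" if "forest_order f = n" for f w n
    using that
  proof (induction n arbitrary: f w rule: less_induct)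
    case (less n)
    have smaller: "T (basis_vec g) = T' (basis_vec g)" if "forest_order g < n" for g
      using less(1)[OF that refl] by blast
    have letter: "T (basis_vec f) u = T' (basis_vec f) u" if "u \<in> {X, Y}" "forest_order f = n" for f u
    proof (cases f)
      case empty
      then show ?thesis by (simp only: D(5) D'(5))
    next
      case (add t g)
      obtain h where t: "t = Bplus h" by (cases t)
      show ?thesis
      proof (cases "g = {#}")
        case True
        then have f: "f = {#Bplus h#}" by (simp add: add t)
        then have "T (basis_vec h) = T' (basis_vec h)" using that by (intro smaller) simp
        then show ?thesis using that D(6-8) D'(6-8) unfolding f by (cases "h = {#}") auto
      next
        case False
        have f: "f = {#Bplus h#} + g" by (simp add: add t)
        \<comment> \<open>Both factors have positive order, so each is smaller than
          \<open>f\<close>.\<close>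
        then have "T (basis_vec {#Bplus h#}) = T' (basis_vec {#Bplus h#})" "T (basis_vec g) = T' (basis_vec g)"
          using that False forest_order_eq_0_iff[of g]
          by (auto intro!: smaller simp del: forest_order_eq_0_iff union_mset_add_mset_left)
        then show ?thesis unfolding f D(9)[OF that(1)] D'(9)[OF that(1)] by simp
      qed
    qed
    have letter': "T (basis_vec a) u = T' (basis_vec a) u" if "u \<in> {X, Y}" "forest_order a \<le> n" for a u
      using that smaller[of a] letter[of u a] by (cases "forest_order a = n") auto
    have word: "T (basis_vec f) (u * w) = T' (basis_vec f) (u * w)"
      if "u \<in> {X, Y}" "forest_order f = n"
        and IH: "\<And>f. forest_order f = n \<Longrightarrow> T (basis_vec f) w = T' (basis_vec f) w" for f u w
      unfolding D(10)[OF that(1)] D'(10)[OF that(1)]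
    \<comment> \<open>Either factor may have full order n: \<open>letter'\<close> covers the left
      one, and \<open>IH\<close>, assumed for all forests of order n, the right one.\<close>
    proof (rule sweedler_cong)
      fix a b :: forest
      assume "forest_order a + forest_order b = forest_order f"
      then have "forest_order a \<le> n" and b: "forest_order b = n \<or> forest_order b < n"
        using that(2) by linarith+
      then have "T (basis_vec a) u = T' (basis_vec a) u"
        using letter' that(1) by blast
      moreover have "T (basis_vec b) w = T' (basis_vec b) w"
        using b IH[of b] smaller[of b] by auto
      ultimately show "T (basis_vec a) u * T (basis_vec b) w = T' (basis_vec a) u * T' (basis_vec b) w"
        by simp
    qed
    show ?case using less(2)
    proof (induction w arbitrary: f rule: ncpoly_induct)
      case one
      \<comment> \<open>The rule is applied to x = x * 1. For nonempty \<open>a\<close> the forest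
        \<open>b\<close> is smaller and the terms cancel; the terms with empty \<open>a\<close> add
        up to x times \<open>?d f\<close> by the counit law. This is therefore 0, and x can be
        removed.\<close>
      let ?d = "\<lambda>b. T (basis_vec b) 1 - T' (basis_vec b) 1"
      have "0 = T (basis_vec f) (X * 1) - T' (basis_vec f) (X * 1)"
        using letter[of X f] one by simp
      also have "\<dots> = sweedler (\<lambda>a b. T (basis_vec a) X * T (basis_vec b) 1
          - T' (basis_vec a) X * T' (basis_vec b) 1) f"
        unfolding sweedler_diff by (subst D(10), simp, subst D'(10), simp_all)
      also have "\<dots> = sweedler (\<lambda>a b. if a = {#} then X * ?d b else 0) f"
      proof (rule sweedler_cong)
        fix a b :: forest
        assume ab: "forest_order a + forest_order b = forest_order f"
        show "T (basis_vec a) X * T (basis_vec b) 1 - T' (basis_vec a) X * T' (basis_vec b) 1 =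
            (if a = {#} then X * ?d b else 0)"
        proof (cases "a = {#}")
          case False
          then have "forest_order a \<noteq> 0" by simp
          then have "T (basis_vec b) = T' (basis_vec b)"
            using ab one by (intro smaller) linarith
          then show ?thesis using letter'[of X a] ab one False by simp
        qed (simp add: D(5) D'(5) right_diff_distrib del: single_one)
      qed
      also have "\<dots> = X * ?d f" by (rule sweedler_counit_left)
      finally have "drop_first (X * ?d f) = drop_first (X * 0)" by simp
      then show ?case unfolding drop_first_X by simp
    qed (simp_all add: word D D')
  qed
  show ?thesis
  proof (intro ext)
    fix p w show "T p w = T' p w"
      by (induction p rule: basis_induct) (simp_all add: basis D D')
  qed
qed

section \<open>Identification of the rooted tree maps, and the formula\<close>

lemma rooted_tree_map_eq: "rooted_tree_map p w = lin_ext (\<lambda>f. tree_map f w) p"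
proof -
  have "rooted_tree_map = (\<lambda>p w. lin_ext (\<lambda>f. tree_map f w) p)"
    unfolding rooted_tree_map_def
    by (intro the_equality is_rooted_tree_maps_tree_map is_rooted_tree_maps_unique)
  then show ?thesis by (rule fun_cong[OF fun_cong])
qed

theorem theorem1p1:
  fixes f :: CK and w :: ncpoly
  shows "rooted_tree_map f (w * X) = (F_poly f \<diamondop> w) * X"
  by (induction f rule: basis_induct)
    (simp_all add: rooted_tree_map_eq F_poly_def tree_map_mult_X lin_ext_add lin_ext_qscale
      diamond_add_left diamond_scale_left distrib_right qscale_mult_left)

end
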